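(* There exist numerical constants $b>0$ and $c>0$ such that the following holds. Let $0<\mu\le L$ and let $g:\mathbb{R}^d\to\mathbb{R}^d$ be $\mu$-quasi-strongly-monotone and $L$-Lipschitz, with solution $z^*$ of $g(z)=0$. Let $\widehat\alpha=b\sqrt{\mu/L}$ and let $\widetilde g:\mathbb{R}^d\to\mathbb{R}^d$ satisfy $\|\widetilde g(z)-g(z)\|_2\le\alpha\|g(z)\|_2$ for all $z\in\mathbb{R}^d$, with some $\alpha\in[0,1)$, $\alpha<\widehat\alpha$. Then for every starting point $z^0\in\mathbb{R}^d$ and every $N\ge0$, the Inexact ExtraGradient method with step size $\eta=\frac{1}{cL}$ started at $z^0$ generates $z^N$ such that $$\|z^N-z^*\|_2^2\le\|z^0-z^*\|_2^2\left(1-\frac{\mu}{2cL}\right)^N.$$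
   Context: $g$ is $\mu$-quasi-strongly-monotone and $L$-Lipschitz if $g(z)=0$ has a solution and, for all $x,y\in\mathbb{R}^d$ and any solution $z^*$ of $g(z)=0$, $\|g(x)-g(y)\|_2\le L\|x-y\|_2$ and $\langle g(x),x-z^*\rangle\ge\mu\|x-z^*\|_2^2$. Inexact ExtraGradient method with step size $\eta$ started at $z^0$: for $k=0,1,2,\dots$, $z^{k+1/2}=z^k-\eta\,\widetilde g(z^k)$, $z^{k+1}=z^k-\eta\,\widetilde g(z^{k+1/2})$. *)

theory Defs
  imports Complex_Main "Jordan_Normal_Form.Matrix"
begin

text \<open>
  The space \<open>\<real>\<^sup>d\<close> is \<^term>\<open>carrier_vec d :: real vec set\<close>, with the dimension a term rather than
  a type. A type-indexed space would place the existential quantifiers over numerical constants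
  inside the quantification over the dimension, so that the constants could depend on it.
\<close>

definition vnorm :: "real vec \<Rightarrow> real" where
  "vnorm v = sqrt (v \<bullet> v)"

definition solution :: "nat \<Rightarrow> (real vec \<Rightarrow> real vec) \<Rightarrow> real vec \<Rightarrow> bool" where
  "solution d g z \<longleftrightarrow> z \<in> carrier_vec d \<and> g z = 0\<^sub>v d"

definition lipschitz_vec :: "nat \<Rightarrow> real \<Rightarrow> (real vec \<Rightarrow> real vec) \<Rightarrow> bool" where
  "lipschitz_vec d L g \<longleftrightarrow>
     (\<forall>x\<in>carrier_vec d. \<forall>y\<in>carrier_vec d. vnorm (g x - g y) \<le> L * vnorm (x - y))"

definition quasi_strongly_monotone :: "nat \<Rightarrow> real \<Rightarrow> (real vec \<Rightarrow> real vec) \<Rightarrow> bool" where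
  "quasi_strongly_monotone d \<mu> g \<longleftrightarrow>
     (\<exists>z. solution d g z) \<and>
     (\<forall>x\<in>carrier_vec d. \<forall>zs. solution d g zs \<longrightarrow> g x \<bullet> (x - zs) \<ge> \<mu> * (vnorm (x - zs))\<^sup>2)"

definition extragradient_half_step :: "real \<Rightarrow> (real vec \<Rightarrow> real vec) \<Rightarrow> real vec \<Rightarrow> real vec" where
  "extragradient_half_step \<eta> gt z = z - \<eta> \<cdot>\<^sub>v gt z"

primrec extragradient ::
    "real \<Rightarrow> (real vec \<Rightarrow> real vec) \<Rightarrow> real vec \<Rightarrow> nat \<Rightarrow> real vec" where
  "extragradient \<eta> gt z0 0 = z0"
| "extragradient \<eta> gt z0 (Suc k) =
     extragradient \<eta> gt z0 k
       - \<eta> \<cdot>\<^sub>v gt (extragradient_half_step \<eta> gt (extragradient \<eta> gt z0 k))"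

end

theory Submission
  imports Defs "HOL-Analysis.L2_Norm"
begin

text \<open>
  One step contracts the squared distance to \<open>z\<^sup>*\<close> by \<open>1 - \<eta>\<mu>/2\<close>; the constants are \<open>b = 1/10\<close> and
  \<open>c = 4\<close>. Write \<open>u = z\<^sup>k\<^sup>+\<^sup>1\<^sup>/\<^sup>2\<close>, \<open>w = u - z\<^sup>*\<close>, \<open>q\<close> and \<open>p\<close> for the inexact values at \<open>z\<^sup>k\<close> and \<open>u\<close>.
  Expanding the square gives
  \<open>\<parallel>z\<^sup>k\<^sup>+\<^sup>1 - z\<^sup>*\<parallel>\<^sup>2 = \<parallel>z\<^sup>k - z\<^sup>*\<parallel>\<^sup>2 - 2\<eta> p \<bullet> w + \<eta>\<^sup>2 (\<parallel>p - q\<parallel>\<^sup>2 - \<parallel>q\<parallel>\<^sup>2)\<close>.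
  All gradients at \<open>z\<^sup>k\<close> and \<open>u\<close> are comparable to \<open>\<parallel>q\<parallel>\<close>, and \<open>\<parallel>p - q\<parallel> \<le> \<parallel>q\<parallel>/2\<close>.
  The inexactness in \<open>p \<bullet> w\<close> is at most \<open>\<alpha> \<parallel>g u\<parallel> \<parallel>w\<parallel>\<close>. Bounding \<open>\<parallel>g u\<parallel>\<close> here by \<open>L \<parallel>w\<parallel>\<close>
  would need \<open>\<alpha>\<close> of order \<open>\<mu>/L\<close>; splitting the product by Young's inequality instead leaves
  \<open>(\<alpha>\<^sup>2/\<mu>) \<parallel>g u\<parallel>\<^sup>2\<close>, which the negative term \<open>- \<eta>\<^sup>2 \<parallel>q\<parallel>\<^sup>2\<close> absorbs once \<open>\<alpha>\<^sup>2\<close> is of order \<open>\<mu>/L\<close>.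
\<close>

section \<open>Euclidean norm on \<open>real vec\<close>\<close>

lemma scalar_prod_self_ge_0: "0 \<le> (v :: real vec) \<bullet> v"
  by (auto simp: scalar_prod_def intro: sum_nonneg)

lemma vnorm_nonneg [simp]: "0 \<le> vnorm v"
  by (simp add: vnorm_def scalar_prod_self_ge_0)

lemma vnorm_power2: "(vnorm v)\<^sup>2 = v \<bullet> v"
  by (simp add: vnorm_def scalar_prod_self_ge_0)

text \<open>Gives access to \<open>L2_set_mult_ineq\<close>, the source of Cauchy-Schwarz
  below.\<close>

lemma vnorm_eq_L2_set: "vnorm v = L2_set (\<lambda>i. v $ i) {0..<dim_vec v}"
  by (simp add: vnorm_def L2_set_def scalar_prod_def power2_eq_square)

lemma abs_scalar_prod_le_vnorm:
  assumes "v \<in> carrier_vec n" "w \<in> carrier_vec n"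
  shows "\<bar>v \<bullet> w\<bar> \<le> vnorm v * vnorm w"
proof -
  have "\<bar>v \<bullet> w\<bar> \<le> (\<Sum>i\<in>{0..<n}. \<bar>v $ i\<bar> * \<bar>w $ i\<bar>)"
    using assms by (auto simp: scalar_prod_def abs_mult[symmetric])
  also have "\<dots> \<le> vnorm v * vnorm w"
    using L2_set_mult_ineq[of "\<lambda>i. v $ i" "\<lambda>i. w $ i" "{0..<n}"] assms
    by (simp add: vnorm_eq_L2_set)
  finally show ?thesis .
qed

lemma vnorm_triangle_ineq:
  assumes "v \<in> carrier_vec n" "w \<in> carrier_vec n"
  shows "vnorm (v + w) \<le> vnorm v + vnorm w"
proof (rule power2_le_imp_le)
  have "(vnorm (v + w))\<^sup>2 = (vnorm v)\<^sup>2 + 2 * (v \<bullet> w) + (vnorm w)\<^sup>2"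
    using assms comm_scalar_prod[OF assms]
    by (simp add: vnorm_power2 add_scalar_prod_distrib[of _ n] scalar_prod_add_distrib[of _ n])
  also have "\<dots> \<le> (vnorm v + vnorm w)\<^sup>2"
    using abs_scalar_prod_le_vnorm[OF assms] by (simp add: power2_sum)
  finally show "(vnorm (v + w))\<^sup>2 \<le> (vnorm v + vnorm w)\<^sup>2" .
qed (simp add: add_nonneg_nonneg)

lemma vnorm_smult: "vnorm (a \<cdot>\<^sub>v v) = \<bar>a\<bar> * vnorm v"
proof -
  have "(a \<cdot>\<^sub>v v) \<bullet> (a \<cdot>\<^sub>v v) = a\<^sup>2 * (v \<bullet> v)"
    by (simp add: power2_eq_square)
  then show ?thesis
    by (simp add: vnorm_def real_sqrt_mult)
qed

lemma vnorm_minus_commute: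
  assumes "v \<in> carrier_vec n" "w \<in> carrier_vec n"
  shows "vnorm (v - w) = vnorm (w - v)"
proof -
  have "v - w = (-1) \<cdot>\<^sub>v (w - v)"
    using assms by (intro eq_vecI) auto
  then show ?thesis
    by (simp add: vnorm_smult)
qed

lemma vnorm_diff_triangle:
  assumes "u \<in> carrier_vec n" "v \<in> carrier_vec n" "w \<in> carrier_vec n"
  shows "vnorm (u - w) \<le> vnorm (u - v) + vnorm (v - w)"
proof -
  have "u - w = (u - v) + (v - w)"
    using assms by (intro eq_vecI) auto
  then show ?thesis
    using assms vnorm_triangle_ineq[of "u - v" n "v - w"] by simp
qed

lemma vnorm_le_add_diff:
  assumes "v \<in> carrier_vec n" "w \<in> carrier_vec n"
  shows "vnorm v \<le> vnorm w + vnorm (v - w)"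
proof -
  have "v = w + (v - w)"
    using assms by (intro eq_vecI) auto
  then show ?thesis
    using assms vnorm_triangle_ineq[of w n "v - w"] by simp
qed

section \<open>Squared-norm expansions and the bound for one step\<close>

lemma vnorm_add_smult_power2:
  assumes "v \<in> carrier_vec n" "w \<in> carrier_vec n"
  shows "(vnorm (v + a \<cdot>\<^sub>v w))\<^sup>2 = (vnorm v)\<^sup>2 + 2 * a * (v \<bullet> w) + a\<^sup>2 * (vnorm w)\<^sup>2"
  using assms comm_scalar_prod[OF assms]
  by (simp add: vnorm_power2 add_scalar_prod_distrib[of _ n] scalar_prod_add_distrib[of _ n]
      power2_eq_square[of a] distrib_left)

text \<open>Both squares are expanded about the half-step error \<open>w\<close>: the cross terms
  with \<open>q\<close> cancel and only \<open>p \<bullet> w\<close> remains, which monotonicity at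
  the half step controls.\<close>

lemma extragradient_step_identity:
  assumes w: "w \<in> carrier_vec n" and p: "p \<in> carrier_vec n" and q: "q \<in> carrier_vec n"
  shows "(vnorm (w + \<eta> \<cdot>\<^sub>v (q - p)))\<^sup>2 =
    (vnorm (w + \<eta> \<cdot>\<^sub>v q))\<^sup>2 - 2 * \<eta> * (p \<bullet> w) + \<eta>\<^sup>2 * ((vnorm (q - p))\<^sup>2 - (vnorm q)\<^sup>2)"
proof -
  have "w \<bullet> (q - p) = w \<bullet> q - p \<bullet> w"
    using w p q by (simp add: scalar_prod_minus_distrib[of _ n] comm_scalar_prod[of p n w])
  then show ?thesis
    unfolding vnorm_add_smult_power2[OF w minus_carrier_vec[OF q p]] vnorm_add_smult_power2[OF w q]
    by (simp add: right_diff_distrib)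
qed

text \<open>Parallelogram law with the square for \<open>-a\<close> dropped.\<close>

lemma vnorm_add_smult_power2_le:
  assumes "v \<in> carrier_vec n" "w \<in> carrier_vec n"
  shows "(vnorm (v + a \<cdot>\<^sub>v w))\<^sup>2 \<le> 2 * (vnorm v)\<^sup>2 + 2 * a\<^sup>2 * (vnorm w)\<^sup>2"
  using vnorm_add_smult_power2[OF assms, of a] vnorm_add_smult_power2[OF assms, of "-a"]
    zero_le_power2[of "vnorm (v + (-a) \<cdot>\<^sub>v w)"]
  by simp

text \<open>The arithmetic of one step: \<open>W\<close>, \<open>H\<close>, \<open>Q\<close>,
  \<open>D\<close> stand for the norms of \<open>w\<close>, \<open>g u\<close>, \<open>q\<close>,
  \<open>q - p\<close>, while \<open>X\<close> is the squared distance before the step and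
  \<open>S\<close> is \<open>p \<bullet> w\<close>.\<close>

lemma extragradient_scalar_bound:
  fixes \<mu> L \<alpha> W H Q D X S :: real
  assumes \<mu>: "0 < \<mu>" "\<mu> \<le> L"
    and \<alpha>: "0 \<le> \<alpha>" "\<alpha> \<le> 1/10 * sqrt (\<mu> / L)"
    and H: "0 \<le> H" "H \<le> 7/5 * Q" and D: "0 \<le> D" "D \<le> Q / 2"
    and X: "X \<le> 2 * W\<^sup>2 + 2 * (1 / (4*L))\<^sup>2 * Q\<^sup>2"
    and S: "S \<ge> \<mu> * W\<^sup>2 - \<alpha> * H * W"
  shows "X - 2 * (1 / (4*L)) * S + (1 / (4*L))\<^sup>2 * (D\<^sup>2 - Q\<^sup>2) \<le> X * (1 - \<mu> / (8*L))"
proof -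
  define \<eta> where "\<eta> = 1 / (4*L)"
  have L: "0 < L" using \<mu> by simp
  have \<eta>: "0 < \<eta>" and \<eta>L: "L * \<eta> = 1/4" using L by (auto simp: \<eta>_def)
  have \<eta>\<mu>: "\<eta> * \<mu> \<le> 1/4"
    using mult_right_mono[OF \<mu>(2), of \<eta>] \<eta> \<eta>L by (simp add: mult.commute)
  have H2: "H\<^sup>2 \<le> 49/25 * Q\<^sup>2"
    using power_mono[OF H(2) H(1), of 2] by (simp add: power_mult_distrib power2_eq_square)
  have D2: "D\<^sup>2 \<le> Q\<^sup>2 / 4"
    using power_mono[OF D(2) D(1), of 2] by (simp add: power_divide)
  have "\<alpha>\<^sup>2 \<le> (1/10 * sqrt (\<mu> / L))\<^sup>2"
    using \<alpha> by (intro power_mono)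
  also have "\<dots> = 1/100 * (\<mu> / L)"
    using \<mu> L by (simp add: power_mult_distrib power_divide real_sqrt_pow2)
  also have "\<dots> = 1/25 * (\<mu> * \<eta>)"
    using L by (simp add: \<eta>_def)
  finally have \<alpha>2: "\<alpha>\<^sup>2 \<le> 1/25 * (\<mu> * \<eta>)" .
  have young: "2 * (\<alpha> * H * W) \<le> \<mu> / 2 * W\<^sup>2 + 2/25 * \<eta> * H\<^sup>2"
  proof -
    \<comment> \<open>The weights make the \<open>W\<close> part cost a quarter of the monotonicity
      gain \<open>2 * \<mu> * W\<^sup>2\<close>.\<close>
    have "0 \<le> (\<mu> * W - 2 * \<alpha> * H)\<^sup>2" by simp
    then have "\<mu> * (4 * (\<alpha> * H * W)) \<le> \<mu>\<^sup>2 * W\<^sup>2 + 4 * (\<alpha>\<^sup>2 * H\<^sup>2)"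
      by (simp add: power2_eq_square algebra_simps)
    also have "\<dots> \<le> \<mu>\<^sup>2 * W\<^sup>2 + 4 * (1/25 * (\<mu> * \<eta>) * H\<^sup>2)"
      using mult_right_mono[OF \<alpha>2 zero_le_power2[of H]] by linarith
    also have "\<dots> = \<mu> * (\<mu> * W\<^sup>2 + 4/25 * \<eta> * H\<^sup>2)"
      by (simp add: power2_eq_square algebra_simps)
    finally show ?thesis using \<mu>(1) by simp
  qed
  have inexact: "- 2 * \<eta> * S \<le> - (3/2) * (\<eta> * \<mu> * W\<^sup>2) + 2/25 * (\<eta>\<^sup>2 * H\<^sup>2)"
  proof -
    have "- 2 * S \<le> - (3/2) * (\<mu> * W\<^sup>2) + 2/25 * \<eta> * H\<^sup>2"
      using S young by (simp add: field_simps)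
    from mult_left_mono[OF this, of \<eta>] \<eta> show ?thesis
      by (simp add: power2_eq_square algebra_simps)
  qed
  \<comment> \<open>This is the decrease to be paid for; \<open>\<eta> * \<mu> \<le> 1/4\<close>
    keeps its \<open>Q\<close> part below a quarter of the negative term.\<close>
  have dist: "\<eta> * \<mu> / 2 * X \<le> \<eta> * \<mu> * W\<^sup>2 + 1/4 * (\<eta>\<^sup>2 * Q\<^sup>2)"
  proof -
    have "\<eta> * \<mu> / 2 * X \<le> \<eta> * \<mu> / 2 * (2 * W\<^sup>2 + 2 * \<eta>\<^sup>2 * Q\<^sup>2)"
      using X \<eta> \<mu>(1) unfolding \<eta>_def[symmetric] by (intro mult_left_mono) auto
    also have "\<dots> = \<eta> * \<mu> * W\<^sup>2 + \<eta> * \<mu> * (\<eta>\<^sup>2 * Q\<^sup>2)"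
      by (simp add: algebra_simps)
    also have "\<dots> \<le> \<eta> * \<mu> * W\<^sup>2 + 1/4 * (\<eta>\<^sup>2 * Q\<^sup>2)"
      using mult_right_mono[OF \<eta>\<mu>, of "\<eta>\<^sup>2 * Q\<^sup>2"] by simp
    finally show ?thesis .
  qed
  have H2': "\<eta>\<^sup>2 * H\<^sup>2 \<le> 49/25 * (\<eta>\<^sup>2 * Q\<^sup>2)" and D2': "\<eta>\<^sup>2 * D\<^sup>2 \<le> 1/4 * (\<eta>\<^sup>2 * Q\<^sup>2)"
    using mult_left_mono[OF H2, of "\<eta>\<^sup>2"] mult_left_mono[OF D2, of "\<eta>\<^sup>2"] by simp_all
  have pos: "0 \<le> \<eta> * \<mu> * W\<^sup>2" "0 \<le> \<eta>\<^sup>2 * Q\<^sup>2" using \<eta> \<mu> by simp_all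
  have "X * (1 - \<mu> / (8*L)) = X - \<eta> * \<mu> / 2 * X"
    by (simp add: \<eta>_def algebra_simps)
  moreover have "\<eta>\<^sup>2 * (D\<^sup>2 - Q\<^sup>2) = \<eta>\<^sup>2 * D\<^sup>2 - \<eta>\<^sup>2 * Q\<^sup>2"
    by (simp add: algebra_simps)
  \<comment> \<open>After moving \<open>X\<close> over, \<open>\<eta> * \<mu> * W\<^sup>2\<close>
    has coefficient -3/2 + 1 and \<open>\<eta>\<^sup>2 * Q\<^sup>2\<close> has 2/25 * 49/25 + 1/4 +
    1/4 - 1; both are negative.\<close>
  ultimately show ?thesis
    unfolding \<eta>_def[symmetric] using inexact dist H2' D2' pos by linarith
qed

lemma extragradient_step_contraction:
  assumes \<mu>: "0 < \<mu>" "\<mu> \<le> L"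
    and g: "g \<in> carrier_vec d \<rightarrow> carrier_vec d"
    and qsm: "quasi_strongly_monotone d \<mu> g" and lip: "lipschitz_vec d L g"
    and zs: "solution d g zs"
    and gt: "gt \<in> carrier_vec d \<rightarrow> carrier_vec d"
    and \<alpha>: "0 \<le> \<alpha>" "\<alpha> \<le> 1/10 * sqrt (\<mu> / L)"
    and inexact: "\<forall>z\<in>carrier_vec d. vnorm (gt z - g z) \<le> \<alpha> * vnorm (g z)"
    and z: "z \<in> carrier_vec d"
  shows "(vnorm (z - (1 / (4*L)) \<cdot>\<^sub>v gt (extragradient_half_step (1 / (4*L)) gt z) - zs))\<^sup>2
    \<le> (vnorm (z - zs))\<^sup>2 * (1 - \<mu> / (8*L))"
proof -
  define \<eta> where "\<eta> = 1 / (4*L)"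
  define u where "u = extragradient_half_step \<eta> gt z"
  define q where "q = gt z"
  define p where "p = gt u"
  define w where "w = u - zs"
  have L: "0 < L" using \<mu> by simp
  have \<eta>: "0 < \<eta>" and \<eta>L: "L * \<eta> = 1/4" using L by (auto simp: \<eta>_def)
  have q: "q \<in> carrier_vec d" using gt z by (auto simp: q_def)
  have u: "u \<in> carrier_vec d"
    using z q by (simp add: u_def extragradient_half_step_def q_def)
  have p: "p \<in> carrier_vec d" using gt u by (auto simp: p_def)
  have zs_carrier: "zs \<in> carrier_vec d" using zs by (simp add: solution_def)
  have w: "w \<in> carrier_vec d" using u zs_carrier by (simp add: w_def)
  have gz: "g z \<in> carrier_vec d" and gu: "g u \<in> carrier_vec d" using g z u by auto

  have "\<mu> / L \<le> 1" using \<mu> by simp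
  then have \<alpha>': "\<alpha> \<le> 1/10" using \<alpha> real_sqrt_le_mono[of "\<mu> / L" 1] unfolding real_sqrt_one by linarith

  have "u - z = (-\<eta>) \<cdot>\<^sub>v q"
    using z q by (intro eq_vecI) (auto simp: u_def extragradient_half_step_def q_def)
  then have "vnorm (u - z) = \<eta> * vnorm q" using \<eta> by (simp add: vnorm_smult)
  moreover have "vnorm (g u - g z) \<le> L * vnorm (u - z)"
    using lip u z by (simp add: lipschitz_vec_def)
  ultimately have gdiff: "vnorm (g u - g z) \<le> vnorm q / 4"
    using \<eta>L by (simp flip: mult.assoc)
  have e1: "vnorm (q - g z) \<le> vnorm (g z) / 10"
    using inexact z mult_right_mono[OF \<alpha>', of "vnorm (g z)"] by (force simp: q_def)
  have e2: "vnorm (p - g u) \<le> \<alpha> * vnorm (g u)"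
    using inexact u by (simp add: p_def)
  then have e2': "vnorm (p - g u) \<le> vnorm (g u) / 10"
    using mult_right_mono[OF \<alpha>', of "vnorm (g u)"] by simp
  \<comment> \<open>Relative error 1/10 gives 10/9 = 1/(1 - 1/10). Then 49/36 = 10/9 + 1/4, and
    \<open>D\<close> sums 49/360 + 1/4 + 1/9 = 179/360, just below 1/2.\<close>
  have G: "vnorm (g z) \<le> 10/9 * vnorm q"
    using vnorm_le_add_diff[OF gz q] vnorm_minus_commute[OF gz q] e1 by simp
  have H: "vnorm (g u) \<le> 49/36 * vnorm q"
    using vnorm_le_add_diff[OF gu gz] gdiff G by simp
  have D: "vnorm (q - p) \<le> vnorm q / 2"
    using vnorm_diff_triangle[OF p gu q] vnorm_diff_triangle[OF gu gz q]
      vnorm_minus_commute[OF gz q] vnorm_minus_commute[OF p q] e1 e2' gdiff G H vnorm_nonneg[of q]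
    by linarith

  \<comment> \<open>Here \<open>\<alpha>\<close> itself is kept instead of 1/10, since the Young
    step needs its square to be of order \<open>\<mu> / L\<close>.\<close>
  have S: "p \<bullet> w \<ge> \<mu> * (vnorm w)\<^sup>2 - \<alpha> * vnorm (g u) * vnorm w"
  proof -
    have "g u \<bullet> w \<ge> \<mu> * (vnorm w)\<^sup>2"
      using qsm u zs by (simp add: quasi_strongly_monotone_def w_def)
    moreover have "\<bar>(p - g u) \<bullet> w\<bar> \<le> \<alpha> * vnorm (g u) * vnorm w"
      using abs_scalar_prod_le_vnorm[of "p - g u" d w] mult_right_mono[OF e2, of "vnorm w"] p gu w
      by simp
    moreover have "(p - g u) \<bullet> w = p \<bullet> w - g u \<bullet> w"
      using p gu w by (simp add: minus_scalar_prod_distrib[of _ d])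
    ultimately show ?thesis by linarith
  qed

  have x: "z - zs = w + \<eta> \<cdot>\<^sub>v q"
    using z q zs_carrier
    by (intro eq_vecI) (auto simp: w_def u_def extragradient_half_step_def q_def)
  have x': "z - \<eta> \<cdot>\<^sub>v p - zs = w + \<eta> \<cdot>\<^sub>v (q - p)"
    using z q p zs_carrier
    by (intro eq_vecI) (auto simp: w_def u_def extragradient_half_step_def q_def algebra_simps)
  have "(vnorm (z - \<eta> \<cdot>\<^sub>v p - zs))\<^sup>2 = (vnorm (z - zs))\<^sup>2 - 2 * \<eta> * (p \<bullet> w)
      + \<eta>\<^sup>2 * ((vnorm (q - p))\<^sup>2 - (vnorm q)\<^sup>2)"
    unfolding x x' by (rule extragradient_step_identity[OF w p q])
  also have "\<dots> \<le> (vnorm (z - zs))\<^sup>2 * (1 - \<mu> / (8*L))"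
    unfolding \<eta>_def
  proof (rule extragradient_scalar_bound[OF \<mu> \<alpha> _ _ _ D _ S])
    show "vnorm (g u) \<le> 7/5 * vnorm q"
      using H vnorm_nonneg[of q] by linarith
    show "(vnorm (z - zs))\<^sup>2 \<le> 2 * (vnorm w)\<^sup>2 + 2 * (1 / (4*L))\<^sup>2 * (vnorm q)\<^sup>2"
      using vnorm_add_smult_power2_le[OF w q, of \<eta>] unfolding x by (simp add: \<eta>_def)
  qed simp_all
  finally show ?thesis
    by (simp add: \<eta>_def p_def u_def)
qed

section \<open>Iterating the one-step bound\<close>

lemma extragradient_carrier:
  assumes "gt \<in> carrier_vec d \<rightarrow> carrier_vec d" "z0 \<in> carrier_vec d"
  shows "extragradient \<eta> gt z0 k \<in> carrier_vec d"
proof (induction k)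
  case (Suc k)
  then have "extragradient_half_step \<eta> gt (extragradient \<eta> gt z0 k) \<in> carrier_vec d"
    using funcset_mem[OF assms(1)] by (simp add: extragradient_half_step_def)
  then have "gt (extragradient_half_step \<eta> gt (extragradient \<eta> gt z0 k)) \<in> carrier_vec d"
    by (rule funcset_mem[OF assms(1)])
  then show ?case
    using Suc by simp
qed (use assms in simp)

theorem theorem16:
  shows "\<exists>b>0::real. \<exists>c>0::real.
    \<forall>(d::nat) (\<mu>::real) (L::real) (g::real vec \<Rightarrow> real vec) (zs::real vec)
     (\<alpha>::real) (gt::real vec \<Rightarrow> real vec) (z0::real vec) (N::nat).
      0 < \<mu> \<longrightarrow> \<mu> \<le> L \<longrightarrow>
      g \<in> carrier_vec d \<rightarrow> carrier_vec d \<longrightarrow>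
      quasi_strongly_monotone d \<mu> g \<longrightarrow>
      lipschitz_vec d L g \<longrightarrow>
      solution d g zs \<longrightarrow>
      gt \<in> carrier_vec d \<rightarrow> carrier_vec d \<longrightarrow>
      0 \<le> \<alpha> \<longrightarrow> \<alpha> < 1 \<longrightarrow> \<alpha> < b * sqrt (\<mu> / L) \<longrightarrow>
      (\<forall>z\<in>carrier_vec d. vnorm (gt z - g z) \<le> \<alpha> * vnorm (g z)) \<longrightarrow>
      z0 \<in> carrier_vec d \<longrightarrow>
      (vnorm (extragradient (1 / (c * L)) gt z0 N - zs))\<^sup>2
        \<le> (vnorm (z0 - zs))\<^sup>2 * (1 - \<mu> / (2 * c * L)) ^ N"
proof (rule exI[of _ "1/10"], rule conjI, simp, rule exI[of _ 4], intro conjI allI impI)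
  fix d :: nat and \<mu> L :: real and g :: "real vec \<Rightarrow> real vec" and zs :: "real vec"
    and \<alpha> :: real and gt :: "real vec \<Rightarrow> real vec" and z0 :: "real vec" and N :: nat
  assume A: "0 < \<mu>" "\<mu> \<le> L" "g \<in> carrier_vec d \<rightarrow> carrier_vec d"
      "quasi_strongly_monotone d \<mu> g" "lipschitz_vec d L g" "solution d g zs"
      "gt \<in> carrier_vec d \<rightarrow> carrier_vec d" "0 \<le> \<alpha>"
    and \<alpha>: "\<alpha> < 1/10 * sqrt (\<mu> / L)"
    and inexact: "\<forall>z\<in>carrier_vec d. vnorm (gt z - g z) \<le> \<alpha> * vnorm (g z)"
    and z0: "z0 \<in> carrier_vec d"
  \<comment> \<open>Nonnegativity allows multiplying the induction hypothesis by the factor.\<close>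
  have factor: "0 \<le> 1 - \<mu> / (8*L)"
    using A(1,2) by (simp add: field_simps)
  have "(vnorm (extragradient (1 / (4*L)) gt z0 N - zs))\<^sup>2
      \<le> (vnorm (z0 - zs))\<^sup>2 * (1 - \<mu> / (8*L)) ^ N"
  proof (induction N)
    case (Suc N)
    have "(vnorm (extragradient (1 / (4*L)) gt z0 (Suc N) - zs))\<^sup>2
        \<le> (vnorm (extragradient (1 / (4*L)) gt z0 N - zs))\<^sup>2 * (1 - \<mu> / (8*L))"
      using extragradient_step_contraction[OF A less_imp_le[OF \<alpha>] inexact
          extragradient_carrier[OF A(7) z0]] by simp
    also have "\<dots> \<le> (vnorm (z0 - zs))\<^sup>2 * (1 - \<mu> / (8*L)) ^ N * (1 - \<mu> / (8*L))"
      using Suc factor by (rule mult_right_mono)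
    finally show ?case
      by (simp add: ac_simps)
  qed simp
  then show "(vnorm (extragradient (1 / (4 * L)) gt z0 N - zs))\<^sup>2
      \<le> (vnorm (z0 - zs))\<^sup>2 * (1 - \<mu> / (2 * 4 * L)) ^ N"
    by simp
qed simp_all

end
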